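(* Let $n\ge 2$ and let $G$ be a nilpotent subgroup of $\mathcal{A}_n=\mathrm{Aut}(T_n)$ which contains the $n$-adic adding machine $\tau$. Then $G$ is a subgroup of $\overline{\langle\tau\rangle}$.
   Context: Let $Y=\{0,1,\dots,n-1\}$, and let $T_n$ be the regular rooted $n$-ary tree whose vertices are the finite words over $Y$ (root = empty word). $\mathcal{A}_n=\mathrm{Aut}(T_n)$, acting on the right. Each $\alpha\in\mathcal{A}_n$ is written $\alpha=(\alpha|_0,\dots,\alpha|_{n-1})\sigma_\alpha$, where the permutation $\sigma_\alpha$ of $Y$ and $\alpha|_i\in\mathcal{A}_n$ are determined by $(iu)\alpha=(i)\sigma_\alpha\cdot(u)\alpha|_i$ for $i\in Y$ and every word $u$. The adding machine is $\tau=(e,\dots,e,\tau)\sigma_\tau$, with $e$ the identity and $\sigma_\tau$ the cycle $(0,1,\dots,n-1)$, $i\mapsto i+1\pmod n$. $\overline{\langle\tau\rangle}$ is the closure of $\langle\tau\rangle$ in $\mathcal{A}_n$ for the profinite topology (defined by the level stabilizers of the tree); equivalently $\overline{\langle\tau\rangle}=\{\tau^\xi:\xi\in\mathbb{Z}_n\}$ with $\mathbb{Z}_n=\varprojlim \mathbb{Z}/n^k\mathbb{Z}$ the ring of $n$-adic integers. *)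

theory Defs
  imports "HOL-Algebra.Algebra" "HOL-Analysis.Function_Topology"
begin

definition tree_words :: "nat \<Rightarrow> nat list set" where
  "tree_words n = lists {..<n}"

text \<open>The root is the empty word, and the children of a word \<open>u\<close> are the words \<open>u @ [y]\<close>.\<close>

definition tree_adj :: "nat list \<Rightarrow> nat list \<Rightarrow> bool" where
  "tree_adj u v \<longleftrightarrow> (\<exists>y. v = u @ [y]) \<or> (\<exists>y. u = v @ [y])"

text \<open>Automorphisms are taken extensional, so that equality of functions is equality of
  automorphisms of the tree.\<close>

definition tree_automorphisms :: "nat \<Rightarrow> (nat list \<Rightarrow> nat list) set" where
  "tree_automorphisms n =
     {\<alpha> \<in> extensional (tree_words n).
        bij_betw \<alpha> (tree_words n) (tree_words n) \<and> \<alpha> [] = [] \<and>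
        (\<forall>u\<in>tree_words n. \<forall>v\<in>tree_words n. tree_adj (\<alpha> u) (\<alpha> v) \<longleftrightarrow> tree_adj u v)}"

text \<open>Right action: the product of \<open>\<alpha>\<close> and \<open>\<beta>\<close> applies \<open>\<alpha>\<close> first.\<close>

definition tree_Aut :: "nat \<Rightarrow> (nat list \<Rightarrow> nat list) monoid" where
  "tree_Aut n =
     \<lparr>carrier = tree_automorphisms n,
      monoid.mult = (\<lambda>\<alpha> \<beta>. compose (tree_words n) \<beta> \<alpha>),
      one = (\<lambda>u\<in>tree_words n. u)\<rparr>"

text \<open>For \<open>\<tau> = (e, \<dots>, e, \<tau>)\<sigma>\<close> with \<open>\<sigma>\<close> the cycle \<open>i \<mapsto> i + 1 mod n\<close>, the recursion
  \<open>(iu)\<tau> = (i)\<sigma> (u)\<tau>|\<^sub>i\<close> reads as follows.\<close>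

primrec odometer :: "nat \<Rightarrow> nat list \<Rightarrow> nat list" where
  "odometer n [] = []"
| "odometer n (i # u) = (Suc i mod n) # (if i = n - 1 then odometer n u else u)"

definition adding_machine :: "nat \<Rightarrow> nat list \<Rightarrow> nat list" where
  "adding_machine n = restrict (odometer n) (tree_words n)"

definition level_stabilizer :: "nat \<Rightarrow> nat \<Rightarrow> (nat list \<Rightarrow> nat list) set" where
  "level_stabilizer n k =
     {\<alpha> \<in> tree_automorphisms n. \<forall>u\<in>tree_words n. length u = k \<longrightarrow> \<alpha> u = u}"

definition profinite_topology :: "nat \<Rightarrow> (nat list \<Rightarrow> nat list) topology" where
  "profinite_topology n =
     topology_generated_by
       {\<alpha> <#\<^bsub>tree_Aut n\<^esub> level_stabilizer n k | \<alpha> k. \<alpha> \<in> tree_automorphisms n}"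

definition adding_machine_closure :: "nat \<Rightarrow> (nat list \<Rightarrow> nat list) set" where
  "adding_machine_closure n =
     profinite_topology n closure_of generate (tree_Aut n) {adding_machine n}"

primrec lower_central_series :: "('a, 'b) monoid_scheme \<Rightarrow> nat \<Rightarrow> 'a set" where
  "lower_central_series G 0 = carrier G"
| "lower_central_series G (Suc i) =
     generate G (\<Union>x\<in>lower_central_series G i. \<Union>y\<in>carrier G.
       {x \<otimes>\<^bsub>G\<^esub> y \<otimes>\<^bsub>G\<^esub> (inv\<^bsub>G\<^esub> x) \<otimes>\<^bsub>G\<^esub> (inv\<^bsub>G\<^esub> y)})"

definition nilpotent_group :: "('a, 'b) monoid_scheme \<Rightarrow> bool" where
  "nilpotent_group G \<longleftrightarrow> group G \<and> (\<exists>c. lower_central_series G c = {\<one>\<^bsub>G\<^esub>})"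

lemma tree_automorphism_closed:
  "\<alpha> \<in> tree_automorphisms n \<Longrightarrow> u \<in> tree_words n \<Longrightarrow> \<alpha> u \<in> tree_words n"
  by (auto simp: tree_automorphisms_def dest: bij_betwE)

lemma Nil_in_tree_words [simp]: "[] \<in> tree_words n"
  by (simp add: tree_words_def)

lemma group_tree_Aut: "group (tree_Aut n)"
proof (rule groupI)
  let ?W = "tree_words n"
  fix \<alpha> \<beta> assume a: "\<alpha> \<in> carrier (tree_Aut n)" and b: "\<beta> \<in> carrier (tree_Aut n)"
  have A: "\<alpha> \<in> tree_automorphisms n" and B: "\<beta> \<in> tree_automorphisms n"
    using a b by (simp_all add: tree_Aut_def)
  have "bij_betw (compose ?W \<beta> \<alpha>) ?W ?W"
    using A B by (auto intro: bij_betw_compose simp: tree_automorphisms_def)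
  then show "\<alpha> \<otimes>\<^bsub>tree_Aut n\<^esub> \<beta> \<in> carrier (tree_Aut n)"
    using A B tree_automorphism_closed[OF A]
    by (simp add: tree_Aut_def tree_automorphisms_def compose_eq)
next
  show "\<one>\<^bsub>tree_Aut n\<^esub> \<in> carrier (tree_Aut n)"
    by (auto simp: tree_Aut_def tree_automorphisms_def bij_betw_def inj_on_def)
next
  let ?W = "tree_words n"
  fix \<alpha> \<beta> \<gamma> assume "\<alpha> \<in> carrier (tree_Aut n)" "\<beta> \<in> carrier (tree_Aut n)"
    "\<gamma> \<in> carrier (tree_Aut n)"
  then show "\<alpha> \<otimes>\<^bsub>tree_Aut n\<^esub> \<beta> \<otimes>\<^bsub>tree_Aut n\<^esub> \<gamma> = \<alpha> \<otimes>\<^bsub>tree_Aut n\<^esub> (\<beta> \<otimes>\<^bsub>tree_Aut n\<^esub> \<gamma>)"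
    by (auto simp: tree_Aut_def compose_def fun_eq_iff tree_automorphism_closed)
next
  fix \<alpha> assume "\<alpha> \<in> carrier (tree_Aut n)"
  then show "\<one>\<^bsub>tree_Aut n\<^esub> \<otimes>\<^bsub>tree_Aut n\<^esub> \<alpha> = \<alpha>"
    by (auto simp: tree_Aut_def tree_automorphisms_def compose_def fun_eq_iff extensional_def)
next
  let ?W = "tree_words n"
  fix \<alpha> assume "\<alpha> \<in> carrier (tree_Aut n)"
  then have A: "\<alpha> \<in> tree_automorphisms n" by (simp add: tree_Aut_def)
  then have bij: "bij_betw \<alpha> ?W ?W" and root: "\<alpha> [] = []"
    and adj: "\<And>u v. u \<in> ?W \<Longrightarrow> v \<in> ?W \<Longrightarrow> tree_adj (\<alpha> u) (\<alpha> v) \<longleftrightarrow> tree_adj u v"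
    by (auto simp: tree_automorphisms_def)
  define \<beta> where "\<beta> = restrict (inv_into ?W \<alpha>) ?W"
  have bijb: "bij_betw \<beta> ?W ?W"
    unfolding \<beta>_def using bij by (simp add: bij_betw_inv_into bij_betw_restrict_eq)
  have l: "\<beta> (\<alpha> u) = u" if "u \<in> ?W" for u
    using that bij bij_betw_inv_into_left[OF bij that] tree_automorphism_closed[OF A that]
    by (simp add: \<beta>_def)
  have r: "\<alpha> (\<beta> u) = u" if "u \<in> ?W" for u
    using that bij_betw_inv_into_right[OF bij that] by (simp add: \<beta>_def)
  have bW: "\<beta> u \<in> ?W" if "u \<in> ?W" for u
    using bijb that by (auto dest: bij_betwE)
  have rootb: "\<beta> [] = []" using l[of "[]"] root by simp
  have adjb: "tree_adj (\<beta> u) (\<beta> v) \<longleftrightarrow> tree_adj u v" if "u \<in> ?W" "v \<in> ?W" for u v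
    using adj[OF bW bW, OF that] r that by simp
  have "\<beta> \<in> tree_automorphisms n"
    using bijb rootb adjb by (auto simp: tree_automorphisms_def \<beta>_def)
  moreover have "compose ?W \<alpha> \<beta> = (\<lambda>u\<in>?W. u)"
    by (auto simp: compose_def fun_eq_iff r)
  ultimately show "\<exists>\<beta>\<in>carrier (tree_Aut n). \<beta> \<otimes>\<^bsub>tree_Aut n\<^esub> \<alpha> = \<one>\<^bsub>tree_Aut n\<^esub>"
    by (auto simp: tree_Aut_def)
qed

lemma odometer_append:
  "\<exists>z. odometer n (u @ [y]) = odometer n u @ [z]"
  by (induction u) auto

lemma length_odometer [simp]: "length (odometer n u) = length u"
  by (induction u) auto

lemma mod_Suc_inj: "i < n \<Longrightarrow> j < n \<Longrightarrow> Suc i mod n = Suc j mod n \<Longrightarrow> i = j"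
  by (auto simp: mod_Suc split: if_splits)

lemma odometer_inj:
  "u \<in> tree_words n \<Longrightarrow> v \<in> tree_words n \<Longrightarrow> odometer n u = odometer n v \<Longrightarrow> u = v"
proof (induction u arbitrary: v)
  case Nil
  then show ?case by (cases v) auto
next
  case (Cons i u)
  then obtain j w where v: "v = j # w" by (cases v) auto
  have "i = j"
    using Cons.prems v mod_Suc_inj[of i n j] by (auto simp: tree_words_def)
  then show ?case
    using Cons v by (auto simp: tree_words_def split: if_splits)
qed

lemma odometer_surj:
  "v \<in> tree_words n \<Longrightarrow> \<exists>u\<in>tree_words n. odometer n u = v"
proof (induction v)
  case Nil
  then show ?case by (intro bexI[of _ "[]"]) auto
next
  case (Cons j v)
  then have j: "j < n" and v: "v \<in> tree_words n" by (auto simp: tree_words_def)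
  from Cons.IH[OF v] obtain u where u: "u \<in> tree_words n" "odometer n u = v" by blast
  show ?case
  proof (cases "j = 0")
    case True
    then show ?thesis using u j
      by (intro bexI[of _ "(n - 1) # u"]) (auto simp: tree_words_def)
  next
    case False
    then show ?thesis using v j
      by (intro bexI[of _ "(j - 1) # v"]) (auto simp: tree_words_def)
  qed
qed

lemma odometer_closed: "u \<in> tree_words n \<Longrightarrow> odometer n u \<in> tree_words n"
  by (induction u) (auto simp: tree_words_def)

lemma adding_machine_in_tree_Aut: "adding_machine n \<in> carrier (tree_Aut n)"
proof -
  let ?W = "tree_words n"
  have child: "(\<exists>z. odometer n v = odometer n u @ [z]) \<longleftrightarrow> (\<exists>y. v = u @ [y])"
    if u: "u \<in> ?W" and v: "v \<in> ?W" for u v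
  proof
    assume "\<exists>z. odometer n v = odometer n u @ [z]"
    then obtain z where z: "odometer n v = odometer n u @ [z]" by blast
    then have "v \<noteq> []" by auto
    then obtain w y where w: "v = w @ [y]" by (metis append_butlast_last_id)
    obtain z' where "odometer n v = odometer n w @ [z']"
      using odometer_append w by blast
    then have "odometer n w = odometer n u" using z by simp
    moreover have "w \<in> ?W" using v w by (simp add: tree_words_def)
    ultimately show "\<exists>y. v = u @ [y]" using odometer_inj u w by blast
  qed (use odometer_append in blast)
  have "bij_betw (odometer n) ?W ?W"
    unfolding bij_betw_def inj_on_def image_def
    using odometer_inj odometer_surj odometer_closed by blast
  then have "bij_betw (adding_machine n) ?W ?W"
    by (simp add: adding_machine_def bij_betw_restrict_eq)
  then show ?thesis
    using child
    by (simp add: tree_Aut_def tree_automorphisms_def tree_adj_def adding_machine_def)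
qed

lemma topspace_profinite_topology: "topspace (profinite_topology n) = carrier (tree_Aut n)"
proof
  interpret group "tree_Aut n" by (rule group_tree_Aut)
  have sub: "level_stabilizer n k \<subseteq> carrier (tree_Aut n)" for k
    by (auto simp: level_stabilizer_def tree_Aut_def)
  show "topspace (profinite_topology n) \<subseteq> carrier (tree_Aut n)"
    unfolding profinite_topology_def topology_generated_by_topspace
    using l_coset_subset_G[OF sub] by (fastforce simp: tree_Aut_def)
  show "carrier (tree_Aut n) \<subseteq> topspace (profinite_topology n)"
  proof
    fix \<alpha> assume a: "\<alpha> \<in> carrier (tree_Aut n)"
    have "\<one>\<^bsub>tree_Aut n\<^esub> \<in> level_stabilizer n 0"
      using one_closed by (auto simp: level_stabilizer_def tree_Aut_def)
    then have "\<alpha> \<in> \<alpha> <#\<^bsub>tree_Aut n\<^esub> level_stabilizer n 0"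
      using a unfolding l_coset_def by force
    then show "\<alpha> \<in> topspace (profinite_topology n)"
      unfolding profinite_topology_def topology_generated_by_topspace
      using a by (auto simp: tree_Aut_def)
  qed
qed

end

theory Submission
  imports Defs "HOL-Number_Theory.Cong"
begin

text \<open>Reading words as base-\<open>n\<close> numbers identifies level \<open>k\<close> of the tree with the integers modulo
  \<open>n ^ k\<close>, and there the adding machine \<open>\<tau>\<close> becomes the translation by 1. The proof shows that every
  \<open>\<alpha>\<close> in \<open>G\<close> acts on every level as a translation, which means that on each level it agrees with a
  power of \<open>\<tau>\<close> and hence lies in the closure (\<open>in_adding_machine_closure\<close>).

  The argument goes down the lower central series, starting from its trivial term \<open>c\<close>
  (\<open>nilpotent_subgroup_shifts_level\<close>). If all elements of term \<open>i + 1\<close> act as translations and \<open>\<alpha>\<close>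
  is in term \<open>i\<close>, then \<open>\<alpha> \<tau> \<alpha>\<inverse> \<tau>\<inverse>\<close> acts on level \<open>c * k\<close> as a translation, so that
  \<open>\<alpha> \<tau> \<alpha>\<inverse>\<close> acts there as \<open>\<tau> ^ a\<close> for some \<open>a\<close>. Then the \<open>c\<close>-fold commutator \<open>[\<tau>, \<alpha>, \<dots>, \<alpha>]\<close> acts as
  \<open>\<tau> ^ ((1 - a) ^ c)\<close>; as it is trivial by nilpotency, \<open>n ^ (c * k)\<close> divides \<open>(1 - a) ^ c\<close>, and
  therefore \<open>n ^ k\<close> divides \<open>1 - a\<close>. This is where it matters that the \<open>n\<close>-adic integers have no
  nilpotent elements, even when \<open>n\<close> is not prime. Hence \<open>\<alpha>\<close> commutes with \<open>\<tau>\<close> on level \<open>k\<close>, and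
  as \<open>\<tau>\<close> acts there as a single cycle, \<open>\<alpha>\<close> is itself a translation
  (\<open>shifts_level_if_commutes\<close>).\<close>

section \<open>Tree automorphisms and the levels of the tree\<close>

lemma carrier_tree_Aut [simp]: "carrier (tree_Aut n) = tree_automorphisms n"
  by (simp add: tree_Aut_def)

lemma tree_Aut_mult_apply:
  "u \<in> tree_words n \<Longrightarrow> (\<alpha> \<otimes>\<^bsub>tree_Aut n\<^esub> \<beta>) u = \<beta> (\<alpha> u)"
  by (simp add: tree_Aut_def compose_eq)

lemma tree_Aut_one_apply: "u \<in> tree_words n \<Longrightarrow> \<one>\<^bsub>tree_Aut n\<^esub> u = u"
  by (simp add: tree_Aut_def)

lemma tree_Aut_inv_apply:
  assumes "\<alpha> \<in> tree_automorphisms n" "u \<in> tree_words n"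
  shows "(inv\<^bsub>tree_Aut n\<^esub> \<alpha>) (\<alpha> u) = u" "\<alpha> ((inv\<^bsub>tree_Aut n\<^esub> \<alpha>) u) = u"
proof -
  interpret group "tree_Aut n" by (rule group_tree_Aut)
  have a: "\<alpha> \<in> carrier (tree_Aut n)" using assms by simp
  show "(inv\<^bsub>tree_Aut n\<^esub> \<alpha>) (\<alpha> u) = u"
    using r_inv[OF a] tree_Aut_mult_apply tree_Aut_one_apply assms(2) by metis
  show "\<alpha> ((inv\<^bsub>tree_Aut n\<^esub> \<alpha>) u) = u"
    using l_inv[OF a] tree_Aut_mult_apply tree_Aut_one_apply assms(2) by metis
qed

text \<open>The image of a child of \<open>u\<close> cannot be the parent of \<open>\<alpha> u\<close>, since by induction that parent is
  already the image of the parent of \<open>u\<close>.\<close>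

lemma tree_automorphism_append:
  assumes a: "\<alpha> \<in> tree_automorphisms n" and "u @ [y] \<in> tree_words n"
  shows "\<exists>z. \<alpha> (u @ [y]) = \<alpha> u @ [z]"
proof -
  have child: "tree_adj (\<alpha> v) (\<alpha> (v @ [x]))" if "v @ [x] \<in> tree_words n" for v x
  proof -
    have "v \<in> tree_words n" using that by (simp add: tree_words_def)
    then have "tree_adj (\<alpha> v) (\<alpha> (v @ [x])) \<longleftrightarrow> tree_adj v (v @ [x])"
      using a that unfolding tree_automorphisms_def by blast
    then show ?thesis unfolding tree_adj_def by blast
  qed
  show ?thesis
    using assms(2)
  proof (induction u arbitrary: y rule: rev_induct)
    case Nil
    have "tree_adj (\<alpha> []) (\<alpha> [y])" using child[OF Nil] by simp
    moreover have "\<alpha> [] = []" using a by (simp add: tree_automorphisms_def)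
    ultimately show ?case by (simp add: tree_adj_def)
  next
    case (snoc x w)
    have W: "w \<in> tree_words n" "w @ [x] \<in> tree_words n" "(w @ [x]) @ [y] \<in> tree_words n"
      using snoc.prems by (auto simp: tree_words_def)
    have adj: "tree_adj (\<alpha> (w @ [x])) (\<alpha> ((w @ [x]) @ [y]))" using child[OF W(3)] .
    obtain x' where x': "\<alpha> (w @ [x]) = \<alpha> w @ [x']" using snoc.IH W by blast
    have "\<alpha> ((w @ [x]) @ [y]) \<noteq> \<alpha> w"
    proof
      assume "\<alpha> ((w @ [x]) @ [y]) = \<alpha> w"
      moreover have "inj_on \<alpha> (tree_words n)"
        using a by (auto simp: tree_automorphisms_def bij_betw_def)
      ultimately have "(w @ [x]) @ [y] = w" using W by (meson inj_onD)
      then show False by simp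
    qed
    then show ?case using adj x' by (auto simp: tree_adj_def)
  qed
qed

lemma length_tree_automorphism:
  assumes "\<alpha> \<in> tree_automorphisms n" "u \<in> tree_words n"
  shows "length (\<alpha> u) = length u"
  using assms(2)
proof (induction u rule: rev_induct)
  case Nil
  then show ?case using assms(1) by (simp add: tree_automorphisms_def)
next
  case (snoc y u)
  then have "length (\<alpha> u) = length u" by (auto simp: tree_words_def)
  then show ?case using tree_automorphism_append[OF assms(1) snoc.prems] by auto
qed

lemma take_tree_automorphism:
  assumes "\<alpha> \<in> tree_automorphisms n" "u @ v \<in> tree_words n"
  shows "take (length u) (\<alpha> (u @ v)) = \<alpha> u"
  using assms(2)
proof (induction v rule: rev_induct)
  case Nil
  then show ?case using length_tree_automorphism[OF assms(1), of u] by simp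
next
  case (snoc y v)
  have W: "u @ v \<in> tree_words n" "(u @ v) @ [y] \<in> tree_words n"
    using snoc.prems by (auto simp: tree_words_def)
  obtain z where "\<alpha> ((u @ v) @ [y]) = \<alpha> (u @ v) @ [z]"
    using tree_automorphism_append[OF assms(1) W(2)] by blast
  then show ?case
    using snoc.IH[OF W(1)] length_tree_automorphism[OF assms(1) W(1)] by simp
qed

text \<open>The words of length \<open>k\<close>, that is, the vertices at distance \<open>k\<close> from the root.\<close>

definition level :: "nat \<Rightarrow> nat \<Rightarrow> nat list set" where
  "level n k = {u \<in> tree_words n. length u = k}"

lemma level_subset: "u \<in> level n k \<Longrightarrow> u \<in> tree_words n"
  by (simp add: level_def)

lemma tree_automorphism_level:
  "\<alpha> \<in> tree_automorphisms n \<Longrightarrow> u \<in> level n k \<Longrightarrow> \<alpha> u \<in> level n k"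
  by (simp add: level_def tree_automorphism_closed length_tree_automorphism)

lemma replicate_0_level: "n > 0 \<Longrightarrow> replicate k 0 \<in> level n k"
  by (auto simp: level_def tree_words_def)

lemma tree_automorphism_eq_level_mono:
  assumes "n > 0" "\<alpha> \<in> tree_automorphisms n" "\<beta> \<in> tree_automorphisms n" "k \<le> l"
    and eq: "\<And>u. u \<in> level n l \<Longrightarrow> \<alpha> u = \<beta> u" and u: "u \<in> level n k"
  shows "\<alpha> u = \<beta> u"
proof -
  have "u @ replicate (l - k) 0 \<in> level n l"
    using assms(1,4) u by (auto simp: level_def tree_words_def)
  then show ?thesis
    using eq take_tree_automorphism[of _ n u "replicate (l - k) 0"] assms(2,3) level_subset
    by metis
qed

section \<open>The adding machine as addition of one\<close>

text \<open>The number with base-\<open>n\<close> digits \<open>u\<close>, least significant digit first.\<close>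

primrec word_value :: "nat \<Rightarrow> nat list \<Rightarrow> nat" where
  "word_value n [] = 0"
| "word_value n (i # u) = i + n * word_value n u"

lemma word_value_less: "u \<in> tree_words n \<Longrightarrow> word_value n u < n ^ length u"
proof (induction u)
  case (Cons i u)
  then have i: "i < n" and "Suc (word_value n u) \<le> n ^ length u" by (auto simp: tree_words_def)
  then have "n * Suc (word_value n u) \<le> n * n ^ length u" using mult_le_mono2 by blast
  then show ?case using i by simp
qed simp

lemma word_value_inj:
  "u \<in> tree_words n \<Longrightarrow> v \<in> tree_words n \<Longrightarrow> length u = length v \<Longrightarrow>
    word_value n u = word_value n v \<Longrightarrow> u = v"
proof (induction u arbitrary: v)
  case (Cons i u)
  then obtain j w where v: "v = j # w" by (cases v) auto
  have ij: "i < n" "j < n" using Cons.prems v by (auto simp: tree_words_def)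
  have eq: "i + n * word_value n u = j + n * word_value n w" using Cons.prems v by simp
  have "i = (i + n * word_value n u) mod n" using ij by simp
  also have "\<dots> = j" unfolding eq using ij by simp
  finally have "i = j" .
  then show ?case using Cons v eq ij by (auto simp: tree_words_def)
qed simp

lemma word_value_append: "word_value n (u @ v) = word_value n u + n ^ length u * word_value n v"
  by (induction u) (auto simp: algebra_simps)

lemma word_value_replicate_0: "word_value n (replicate k 0) = 0"
  by (induction k) auto

lemma word_value_odometer:
  "u \<in> tree_words n \<Longrightarrow>
    [int (word_value n (odometer n u)) = int (word_value n u) + 1] (mod int n ^ length u)"
proof (induction u)
  case (Cons i u)
  then have i: "i < n" and u: "u \<in> tree_words n" by (auto simp: tree_words_def)
  show ?case
  proof (cases "i = n - 1")
    case True
    have "[int n * int (word_value n (odometer n u)) = int n * (int (word_value n u) + 1)]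
        (mod int n * int n ^ length u)"
      using Cons.IH[OF u] by (simp add: cong_iff_dvd_diff flip: right_diff_distrib)
    then show ?thesis using True i by (simp add: algebra_simps of_nat_diff)
  next
    case False
    then have "Suc i < n" using i by simp
    then show ?thesis using False by (simp add: algebra_simps)
  qed
qed simp

text \<open>On level \<open>k\<close>, identified with the integers modulo \<open>n ^ k\<close> through \<open>word_value\<close>, the map
  \<open>\<alpha>\<close> is the translation by \<open>e\<close>; for a tree automorphism this says that it agrees there with the
  power \<open>\<tau> ^ e\<close> of the adding machine.\<close>

definition shifts_level :: "nat \<Rightarrow> nat \<Rightarrow> (nat list \<Rightarrow> nat list) \<Rightarrow> int \<Rightarrow> bool" where
  "shifts_level n k \<alpha> e \<longleftrightarrow> (\<forall>u\<in>level n k.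
     [int (word_value n (\<alpha> u)) = int (word_value n u) + e] (mod int n ^ k))"

lemma level_eqI:
  assumes "u \<in> level n k" "v \<in> level n k"
    and "[int (word_value n u) = int (word_value n v)] (mod int n ^ k)"
  shows "u = v"
proof -
  have "word_value n u < n ^ k" "word_value n v < n ^ k"
    using word_value_less[of u n] word_value_less[of v n] assms(1,2) by (auto simp: level_def)
  moreover have "[word_value n u = word_value n v] (mod n ^ k)"
    using assms(3) by (metis cong_int_iff of_nat_power)
  ultimately have "word_value n u = word_value n v" by (simp add: cong_def)
  then show ?thesis using assms(1,2) word_value_inj by (auto simp: level_def)
qed

lemma shifts_level_unique:
  assumes "\<alpha> \<in> tree_automorphisms n" "\<beta> \<in> tree_automorphisms n"
    and "shifts_level n k \<alpha> e" "shifts_level n k \<beta> e" "u \<in> level n k"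
  shows "\<alpha> u = \<beta> u"
proof (rule level_eqI)
  show "[int (word_value n (\<alpha> u)) = int (word_value n (\<beta> u))] (mod int n ^ k)"
    using assms(3-5) unfolding shifts_level_def by (meson cong_sym cong_trans)
qed (use assms tree_automorphism_level in blast)+

lemma shifts_level_cong:
  "\<lbrakk>\<And>u. u \<in> level n k \<Longrightarrow> \<alpha> u = \<beta> u\<rbrakk> \<Longrightarrow> shifts_level n k \<alpha> e \<longleftrightarrow> shifts_level n k \<beta> e"
  by (simp add: shifts_level_def)

lemma shifts_level_cong_exponent:
  "shifts_level n k \<alpha> e \<Longrightarrow> [e = f] (mod int n ^ k) \<Longrightarrow> shifts_level n k \<alpha> f"
  unfolding shifts_level_def by (meson cong_add cong_refl cong_trans)

lemma shifts_level_exponents_cong: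
  assumes "n > 0" "shifts_level n k \<alpha> e" "shifts_level n k \<alpha> f"
  shows "[e = f] (mod int n ^ k)"
proof -
  let ?z = "replicate k (0::nat)"
  have "[int (word_value n ?z) + e = int (word_value n ?z) + f] (mod int n ^ k)"
    using assms replicate_0_level unfolding shifts_level_def by (meson cong_sym cong_trans)
  then show ?thesis by (simp add: word_value_replicate_0)
qed

lemma shifts_level_one: "shifts_level n k \<one>\<^bsub>tree_Aut n\<^esub> 0"
  by (simp add: shifts_level_def level_def tree_Aut_one_apply)

lemma shifts_level_mult:
  assumes "\<alpha> \<in> tree_automorphisms n" "shifts_level n k \<alpha> e" "shifts_level n k \<beta> f"
  shows "shifts_level n k (\<alpha> \<otimes>\<^bsub>tree_Aut n\<^esub> \<beta>) (e + f)"
  unfolding shifts_level_def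
proof
  fix u assume u: "u \<in> level n k"
  have "[int (word_value n (\<beta> (\<alpha> u))) = int (word_value n (\<alpha> u)) + f] (mod int n ^ k)"
    using assms tree_automorphism_level[OF _ u] by (auto simp: shifts_level_def)
  moreover have "[int (word_value n (\<alpha> u)) + f = (int (word_value n u) + e) + f] (mod int n ^ k)"
    using assms u by (auto simp: shifts_level_def intro: cong_add)
  ultimately show "[int (word_value n ((\<alpha> \<otimes>\<^bsub>tree_Aut n\<^esub> \<beta>) u)) = int (word_value n u) + (e + f)]
      (mod int n ^ k)"
    using u by (simp add: tree_Aut_mult_apply level_def add.assoc) (blast intro: cong_trans)
qed

lemma shifts_level_inv:
  assumes "\<alpha> \<in> tree_automorphisms n" "shifts_level n k \<alpha> e"
  shows "shifts_level n k (inv\<^bsub>tree_Aut n\<^esub> \<alpha>) (- e)"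
  unfolding shifts_level_def
proof
  fix u assume u: "u \<in> level n k"
  interpret group "tree_Aut n" by (rule group_tree_Aut)
  let ?v = "(inv\<^bsub>tree_Aut n\<^esub> \<alpha>) u"
  have "?v \<in> level n k"
    using u assms(1) inv_closed[of \<alpha>] tree_automorphism_level by simp
  then have "[int (word_value n (\<alpha> ?v)) = int (word_value n ?v) + e] (mod int n ^ k)"
    using assms(2) by (simp add: shifts_level_def)
  then have "[int (word_value n u) = int (word_value n ?v) + e] (mod int n ^ k)"
    using tree_Aut_inv_apply(2)[OF assms(1)] u by (simp add: level_def)
  then show "[int (word_value n ?v) = int (word_value n u) + - e] (mod int n ^ k)"
    by (simp add: cong_iff_dvd_diff dvd_diff_commute algebra_simps)
qed

lemma shifts_level_adding_machine: "shifts_level n k (adding_machine n) 1"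
  using word_value_odometer by (auto simp: shifts_level_def level_def adding_machine_def)

lemma shifts_level_nat_pow:
  assumes "\<alpha> \<in> tree_automorphisms n" "shifts_level n k \<alpha> e"
  shows "shifts_level n k (\<alpha> [^]\<^bsub>tree_Aut n\<^esub> m) (int m * e)"
proof (induction m)
  case 0
  then show ?case using shifts_level_one by simp
next
  case (Suc m)
  interpret group "tree_Aut n" by (rule group_tree_Aut)
  have "\<alpha> [^]\<^bsub>tree_Aut n\<^esub> m \<in> tree_automorphisms n" using assms(1) nat_pow_closed by simp
  from shifts_level_mult[OF this Suc assms(2)] show ?case
    by (simp add: algebra_simps)
qed

lemma shifts_level_mono:
  assumes "n > 0" "\<alpha> \<in> tree_automorphisms n" "shifts_level n l \<alpha> e" "k \<le> l"
  shows "shifts_level n k \<alpha> e"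
  unfolding shifts_level_def
proof
  fix u assume u: "u \<in> level n k"
  let ?v = "replicate (l - k) (0::nat)"
  have v: "u @ ?v \<in> level n l"
    using assms(1,4) u by (auto simp: level_def tree_words_def)
  have k: "length u = k" "length (\<alpha> u) = k"
    using u tree_automorphism_level[OF assms(2) u] by (auto simp: level_def)
  have "\<alpha> (u @ ?v) = \<alpha> u @ drop k (\<alpha> (u @ ?v))"
    using take_tree_automorphism[OF assms(2) level_subset[OF v]] k
    by (metis append_take_drop_id)
  then have "word_value n (\<alpha> (u @ ?v)) =
      word_value n (\<alpha> u) + n ^ k * word_value n (drop k (\<alpha> (u @ ?v)))"
    using word_value_append k by metis
  then have "[int (word_value n (\<alpha> (u @ ?v))) = int (word_value n (\<alpha> u))] (mod int n ^ k)"
    by (simp add: cong_iff_dvd_diff)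
  moreover have "[int (word_value n (\<alpha> (u @ ?v))) = int (word_value n u) + e] (mod int n ^ k)"
  proof (rule cong_dvd_modulus)
    show "[int (word_value n (\<alpha> (u @ ?v))) = int (word_value n u) + e] (mod int n ^ l)"
      using assms(3) v
      by (force simp: shifts_level_def word_value_append word_value_replicate_0)
    show "int n ^ k dvd int n ^ l" using assms(4) by (rule le_imp_power_dvd)
  qed
  ultimately show "[int (word_value n (\<alpha> u)) = int (word_value n u) + e] (mod int n ^ k)"
    by (blast intro: cong_trans cong_sym)
qed

section \<open>Automorphisms that act on every level as a power of the adding machine\<close>

text \<open>If conjugation by \<open>\<alpha>\<close> turns \<open>\<tau>\<close> into \<open>\<tau> ^ a\<close> on a level, then it turns \<open>\<tau> ^ b\<close> into
  \<open>\<tau> ^ (b * a)\<close>.\<close>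

lemma shifts_level_conj:
  assumes n: "n > 0" and \<alpha>: "\<alpha> \<in> tree_automorphisms n" and \<beta>: "\<beta> \<in> tree_automorphisms n"
    and a: "shifts_level n k (\<alpha> \<otimes>\<^bsub>tree_Aut n\<^esub> adding_machine n \<otimes>\<^bsub>tree_Aut n\<^esub> inv\<^bsub>tree_Aut n\<^esub> \<alpha>) a"
    and b: "shifts_level n k \<beta> b"
  shows "shifts_level n k (\<alpha> \<otimes>\<^bsub>tree_Aut n\<^esub> \<beta> \<otimes>\<^bsub>tree_Aut n\<^esub> inv\<^bsub>tree_Aut n\<^esub> \<alpha>) (b * a)"
proof -
  interpret group "tree_Aut n" by (rule group_tree_Aut)
  let ?A = "tree_Aut n" and ?\<tau> = "adding_machine n"
  \<comment> \<open>A natural number representing \<open>b\<close> modulo \<open>n ^ k\<close>, so that natural powers of \<open>\<tau>\<close> suffice.\<close>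
  define m where "m = nat (b mod int n ^ k)"
  have mb: "[int m = b] (mod int n ^ k)" using n by (simp add: m_def cong_def)
  have \<tau>: "?\<tau> \<in> carrier ?A" by (rule adding_machine_in_tree_Aut)
  have \<alpha>': "\<alpha> \<in> carrier ?A" using \<alpha> by simp
  have "shifts_level n k (?\<tau> [^]\<^bsub>?A\<^esub> m) (int m * 1)"
    using \<tau> by (intro shifts_level_nat_pow shifts_level_adding_machine) simp
  then have "shifts_level n k (?\<tau> [^]\<^bsub>?A\<^esub> m) b"
    using mb shifts_level_cong_exponent by simp
  then have eq: "\<beta> u = (?\<tau> [^]\<^bsub>?A\<^esub> m) u" if "u \<in> level n k" for u
    using \<beta> b that shifts_level_unique nat_pow_closed[OF \<tau>, unfolded carrier_tree_Aut] by blast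
  have cancel: "inv\<^bsub>?A\<^esub> \<alpha> \<otimes>\<^bsub>?A\<^esub> (\<alpha> \<otimes>\<^bsub>?A\<^esub> x) = x" if "x \<in> carrier ?A" for x
    using \<alpha>' that l_inv by (simp del: carrier_tree_Aut flip: m_assoc)
  have conj: "(\<alpha> \<otimes>\<^bsub>?A\<^esub> ?\<tau> \<otimes>\<^bsub>?A\<^esub> inv\<^bsub>?A\<^esub> \<alpha>) [^]\<^bsub>?A\<^esub> m = \<alpha> \<otimes>\<^bsub>?A\<^esub> ?\<tau> [^]\<^bsub>?A\<^esub> m \<otimes>\<^bsub>?A\<^esub> inv\<^bsub>?A\<^esub> \<alpha>"
  proof (induction m)
    case 0
    then show ?case using \<alpha>' by simp
  next
    case (Suc m)
    have p: "?\<tau> [^]\<^bsub>?A\<^esub> m \<in> carrier ?A" using \<tau> by (rule nat_pow_closed)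
    have "(\<alpha> \<otimes>\<^bsub>?A\<^esub> ?\<tau> [^]\<^bsub>?A\<^esub> m \<otimes>\<^bsub>?A\<^esub> inv\<^bsub>?A\<^esub> \<alpha>) \<otimes>\<^bsub>?A\<^esub> (\<alpha> \<otimes>\<^bsub>?A\<^esub> ?\<tau> \<otimes>\<^bsub>?A\<^esub> inv\<^bsub>?A\<^esub> \<alpha>)
        = \<alpha> \<otimes>\<^bsub>?A\<^esub> (?\<tau> [^]\<^bsub>?A\<^esub> m \<otimes>\<^bsub>?A\<^esub> ?\<tau>) \<otimes>\<^bsub>?A\<^esub> inv\<^bsub>?A\<^esub> \<alpha>"
      using \<alpha>' \<tau> p cancel by (simp add: m_assoc del: carrier_tree_Aut)
    then show ?case using Suc by simp
  qed
  have "shifts_level n k ((\<alpha> \<otimes>\<^bsub>?A\<^esub> ?\<tau> \<otimes>\<^bsub>?A\<^esub> inv\<^bsub>?A\<^esub> \<alpha>) [^]\<^bsub>?A\<^esub> m) (int m * a)"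
    using \<alpha>' \<tau> a m_closed inv_closed by (intro shifts_level_nat_pow) auto
  then have "shifts_level n k (\<alpha> \<otimes>\<^bsub>?A\<^esub> ?\<tau> [^]\<^bsub>?A\<^esub> m \<otimes>\<^bsub>?A\<^esub> inv\<^bsub>?A\<^esub> \<alpha>) (b * a)"
    unfolding conj by (rule shifts_level_cong_exponent) (intro cong_mult mb cong_refl)
  then show ?thesis
  proof (rule shifts_level_cong[THEN iffD1, rotated])
    fix u assume u: "u \<in> level n k"
    then show "(\<alpha> \<otimes>\<^bsub>?A\<^esub> ?\<tau> [^]\<^bsub>?A\<^esub> m \<otimes>\<^bsub>?A\<^esub> inv\<^bsub>?A\<^esub> \<alpha>) u = (\<alpha> \<otimes>\<^bsub>?A\<^esub> \<beta> \<otimes>\<^bsub>?A\<^esub> inv\<^bsub>?A\<^esub> \<alpha>) u"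
      using eq[OF tree_automorphism_level[OF \<alpha> u]] by (simp add: tree_Aut_mult_apply level_def)
  qed
qed

text \<open>The level-wise form of the fact that the centralizer of \<open>\<tau>\<close> consists of translations:
  \<open>\<tau>\<close> permutes the level transitively, so the image of \<open>0 \<dots> 0\<close> determines \<open>\<alpha>\<close>.\<close>

lemma shifts_level_if_commutes:
  assumes n: "n > 0" and \<alpha>: "\<alpha> \<in> tree_automorphisms n"
    and 1: "shifts_level n k (\<alpha> \<otimes>\<^bsub>tree_Aut n\<^esub> adding_machine n \<otimes>\<^bsub>tree_Aut n\<^esub> inv\<^bsub>tree_Aut n\<^esub> \<alpha>) 1"
  shows "\<exists>e. shifts_level n k \<alpha> e"
proof -
  interpret group "tree_Aut n" by (rule group_tree_Aut)
  let ?A = "tree_Aut n" and ?\<tau> = "adding_machine n" and ?z = "replicate k (0::nat)"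
  have \<tau>: "?\<tau> \<in> tree_automorphisms n" using adding_machine_in_tree_Aut by simp
  have conj: "\<alpha> \<otimes>\<^bsub>?A\<^esub> ?\<tau> \<otimes>\<^bsub>?A\<^esub> inv\<^bsub>?A\<^esub> \<alpha> \<in> tree_automorphisms n"
    using \<alpha> \<tau> m_closed inv_closed by simp
  have comm: "?\<tau> (\<alpha> u) = \<alpha> (?\<tau> u)" if u: "u \<in> level n k" for u
  proof -
    have "(\<alpha> \<otimes>\<^bsub>?A\<^esub> ?\<tau> \<otimes>\<^bsub>?A\<^esub> inv\<^bsub>?A\<^esub> \<alpha>) u = ?\<tau> u"
      by (rule shifts_level_unique[OF conj \<tau> 1 shifts_level_adding_machine u])
    then have "(inv\<^bsub>?A\<^esub> \<alpha>) (?\<tau> (\<alpha> u)) = ?\<tau> u"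
      using level_subset[OF u] by (simp add: tree_Aut_mult_apply)
    then show ?thesis
      using tree_Aut_inv_apply(2)[OF \<alpha>] tree_automorphism_closed \<alpha> \<tau> level_subset[OF u] by metis
  qed
  define e where "e = int (word_value n (\<alpha> ?z))"
  have z: "?z \<in> level n k" using n by (rule replicate_0_level)
  \<comment> \<open>The witness is the image of \<open>0 \<dots> 0\<close> under \<open>\<tau> ^ m\<close>; no bound on \<open>m\<close> is needed.\<close>
  have step: "\<exists>u\<in>level n k. [int (word_value n u) = int m] (mod int n ^ k) \<and>
      [int (word_value n (\<alpha> u)) = int m + e] (mod int n ^ k)" for m
  proof (induction m)
    case 0
    show ?case using z by (intro bexI[of _ ?z]) (auto simp: word_value_replicate_0 e_def)
  next
    case (Suc m)
    then obtain u where u: "u \<in> level n k" "[int (word_value n u) = int m] (mod int n ^ k)"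
      "[int (word_value n (\<alpha> u)) = int m + e] (mod int n ^ k)" by blast
    have t: "[int (word_value n (?\<tau> v)) = int (word_value n v) + 1] (mod int n ^ k)"
      if "v \<in> level n k" for v
      using shifts_level_adding_machine[of n k] that by (simp add: shifts_level_def)
    have "[int (word_value n (?\<tau> u)) = int m + 1] (mod int n ^ k)"
      using t[OF u(1)] cong_add[OF u(2) cong_refl[of 1]] by (rule cong_trans)
    moreover have "[int (word_value n (\<alpha> (?\<tau> u))) = (int m + e) + 1] (mod int n ^ k)"
      using t[OF tree_automorphism_level[OF \<alpha> u(1)]] cong_add[OF u(3) cong_refl[of 1]]
      unfolding comm[OF u(1)] by (rule cong_trans)
    ultimately show ?case
      using tree_automorphism_level[OF \<tau> u(1)]
      by (intro bexI[of _ "?\<tau> u"]) (auto simp: algebra_simps)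
  qed
  have "shifts_level n k \<alpha> e"
    unfolding shifts_level_def
  proof
    fix u assume u: "u \<in> level n k"
    obtain v where v: "v \<in> level n k" "[int (word_value n v) = int (word_value n u)] (mod int n ^ k)"
      "[int (word_value n (\<alpha> v)) = int (word_value n u) + e] (mod int n ^ k)"
      using step[of "word_value n u"] by blast
    then have "v = u" using u level_eqI by blast
    then show "[int (word_value n (\<alpha> u)) = int (word_value n u) + e] (mod int n ^ k)" using v by simp
  qed
  then show ?thesis ..
qed

text \<open>Every open set around \<open>\<alpha>\<close> contains all automorphisms that agree with \<open>\<alpha>\<close> on some level:
  if \<open>\<alpha>\<close> lies in a generating coset \<open>\<beta> Stab(k)\<close>, then so does everything that agrees with \<open>\<alpha>\<close> on
  level \<open>k\<close>, and two levels are controlled by the deeper one.\<close>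

lemma profinite_topology_open_contains_level:
  assumes n: "n > 0" and U: "openin (profinite_topology n) U" and \<alpha>: "\<alpha> \<in> U" "\<alpha> \<in> tree_automorphisms n"
  shows "\<exists>k. \<forall>\<gamma>\<in>tree_automorphisms n. (\<forall>u\<in>level n k. \<gamma> u = \<alpha> u) \<longrightarrow> \<gamma> \<in> U"
proof -
  interpret group "tree_Aut n" by (rule group_tree_Aut)
  let ?A = "tree_Aut n"
  have "generate_topology_on {\<alpha> <#\<^bsub>?A\<^esub> level_stabilizer n k | \<alpha> k. \<alpha> \<in> tree_automorphisms n} U"
    using U unfolding profinite_topology_def by (rule openin_topology_generated_by)
  then show ?thesis using \<alpha>(1)
  proof (induction rule: generate_topology_on.induct)
    case (Int V W)
    then obtain k l where
      k: "\<forall>\<gamma>\<in>tree_automorphisms n. (\<forall>u\<in>level n k. \<gamma> u = \<alpha> u) \<longrightarrow> \<gamma> \<in> V" and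
      l: "\<forall>\<gamma>\<in>tree_automorphisms n. (\<forall>u\<in>level n l. \<gamma> u = \<alpha> u) \<longrightarrow> \<gamma> \<in> W" by blast
    have "\<gamma> \<in> V \<inter> W" if "\<gamma> \<in> tree_automorphisms n" "\<forall>u\<in>level n (max k l). \<gamma> u = \<alpha> u" for \<gamma>
      using k l that tree_automorphism_eq_level_mono[OF n that(1) \<alpha>(2)]
      by (meson IntI max.cobounded1 max.cobounded2)
    then show ?case by blast
  next
    case (Basis V)
    then obtain \<beta> k where \<beta>: "\<beta> \<in> tree_automorphisms n" and V: "V = \<beta> <#\<^bsub>?A\<^esub> level_stabilizer n k"
      by blast
    then obtain h where h: "h \<in> level_stabilizer n k" "\<alpha> = \<beta> \<otimes>\<^bsub>?A\<^esub> h"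
      using Basis by (auto simp: l_coset_def)
    have "\<gamma> \<in> V" if \<gamma>: "\<gamma> \<in> tree_automorphisms n" "\<forall>u\<in>level n k. \<gamma> u = \<alpha> u" for \<gamma>
    proof -
      define g where "g = inv\<^bsub>?A\<^esub> \<beta> \<otimes>\<^bsub>?A\<^esub> \<gamma>"
      have inv: "inv\<^bsub>?A\<^esub> \<beta> \<in> tree_automorphisms n" using \<beta> inv_closed by simp
      have "g u = u" if "u \<in> level n k" for u
      proof -
        have W: "u \<in> tree_words n" and v: "(inv\<^bsub>?A\<^esub> \<beta>) u \<in> level n k"
          using that level_subset tree_automorphism_level[OF inv that] by auto
        have "g u = h (\<beta> ((inv\<^bsub>?A\<^esub> \<beta>) u))"
          using W v \<gamma>(2) h(2) level_subset[OF v] by (simp add: g_def tree_Aut_mult_apply)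
        also have "\<dots> = h u" using tree_Aut_inv_apply(2)[OF \<beta> W] by simp
        finally show ?thesis using h(1) that by (auto simp: level_stabilizer_def level_def)
      qed
      moreover have "g \<in> tree_automorphisms n" using m_closed inv \<gamma>(1) by (simp add: g_def)
      ultimately have "g \<in> level_stabilizer n k" by (simp add: level_stabilizer_def level_def)
      moreover have "\<gamma> = \<beta> \<otimes>\<^bsub>?A\<^esub> g"
        using \<beta> \<gamma>(1) inv by (simp add: g_def inv_solve_left' flip: m_assoc)
      ultimately show ?thesis unfolding V l_coset_def by blast
    qed
    then show ?case by blast
  qed blast+
qed

lemma in_adding_machine_closure:
  assumes n: "n > 0" and \<alpha>: "\<alpha> \<in> tree_automorphisms n" and e: "\<And>k. \<exists>e. shifts_level n k \<alpha> e"
  shows "\<alpha> \<in> adding_machine_closure n"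
proof -
  interpret group "tree_Aut n" by (rule group_tree_Aut)
  let ?A = "tree_Aut n" and ?\<tau> = "adding_machine n"
  have \<tau>: "?\<tau> \<in> carrier ?A" by (rule adding_machine_in_tree_Aut)
  have "\<exists>\<gamma>. \<gamma> \<in> generate ?A {?\<tau>} \<and> \<gamma> \<in> U" if U: "\<alpha> \<in> U" "openin (profinite_topology n) U" for U
  proof -
    obtain k where k: "\<forall>\<gamma>\<in>tree_automorphisms n. (\<forall>u\<in>level n k. \<gamma> u = \<alpha> u) \<longrightarrow> \<gamma> \<in> U"
      using profinite_topology_open_contains_level[OF n U(2,1) \<alpha>] by blast
    obtain e where e: "shifts_level n k \<alpha> e" using assms(3) by blast
    define m where "m = nat (e mod int n ^ k)"
    have "[int m = e] (mod int n ^ k)" using n by (simp add: m_def cong_def)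
    moreover have "shifts_level n k (?\<tau> [^]\<^bsub>?A\<^esub> m) (int m * 1)"
      using \<tau> by (intro shifts_level_nat_pow shifts_level_adding_machine) simp
    ultimately have "shifts_level n k (?\<tau> [^]\<^bsub>?A\<^esub> m) e"
      using shifts_level_cong_exponent by simp
    moreover have p: "?\<tau> [^]\<^bsub>?A\<^esub> m \<in> tree_automorphisms n" using nat_pow_closed[OF \<tau>] by simp
    ultimately have "?\<tau> [^]\<^bsub>?A\<^esub> m \<in> U"
      using k shifts_level_unique[OF p \<alpha> _ e] by blast
    moreover have "?\<tau> [^]\<^bsub>?A\<^esub> m \<in> generate ?A {?\<tau>}"
      unfolding generate_pow[OF \<tau>] by (auto simp flip: int_pow_int)
    ultimately show ?thesis by blast
  qed
  then show ?thesis
    using \<alpha> by (auto simp: adding_machine_closure_def in_closure_of topspace_profinite_topology)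
qed

section \<open>Descending the lower central series\<close>

lemma lower_central_series_subset:
  assumes "group G"
  shows "lower_central_series G i \<subseteq> carrier G"
proof (induction i)
  case (Suc i)
  interpret group G by fact
  show ?case
    unfolding lower_central_series.simps using Suc by (intro generate_incl) auto
qed simp

lemma commutator_in_lower_central_series:
  assumes "x \<in> lower_central_series G i" "y \<in> carrier G"
  shows "x \<otimes>\<^bsub>G\<^esub> y \<otimes>\<^bsub>G\<^esub> inv\<^bsub>G\<^esub> x \<otimes>\<^bsub>G\<^esub> inv\<^bsub>G\<^esub> y \<in> lower_central_series G (Suc i)"
  using assms by (auto intro!: generate.incl)

text \<open>The nilpotency hypothesis enters as triviality of term \<open>c\<close> of the lower central series.\<close>

lemma nilpotent_subgroup_shifts_level:
  assumes n: "n > 0" and G: "subgroup G (tree_Aut n)" and \<tau>G: "adding_machine n \<in> G"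
    and c: "lower_central_series ((tree_Aut n)\<lparr>carrier := G\<rparr>) c = {\<one>\<^bsub>tree_Aut n\<^esub>}"
    and "\<alpha> \<in> G"
  shows "\<exists>e. shifts_level n k \<alpha> e"
proof -
  interpret group "tree_Aut n" by (rule group_tree_Aut)
  let ?A = "tree_Aut n" and ?\<tau> = "adding_machine n"
  let ?L = "lower_central_series ((tree_Aut n)\<lparr>carrier := G\<rparr>)"
  have LG: "?L i \<subseteq> G" for i
    using lower_central_series_subset[OF subgroup.subgroup_is_group[OF G group_tree_Aut]] by simp
  have GA: "x \<in> tree_automorphisms n" if "x \<in> G" for x
    using subgroup.mem_carrier[OF G that] by simp
  have comm: "x \<otimes>\<^bsub>?A\<^esub> y \<otimes>\<^bsub>?A\<^esub> inv\<^bsub>?A\<^esub> x \<otimes>\<^bsub>?A\<^esub> inv\<^bsub>?A\<^esub> y \<in> ?L (Suc i)"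
    if "x \<in> ?L i" "y \<in> G" for x y i
    using commutator_in_lower_central_series[of x "?A\<lparr>carrier := G\<rparr>" i y] that
      m_inv_consistent[OF G, of x] m_inv_consistent[OF G, of y] subsetD[OF LG that(1)]
    by (simp del: lower_central_series.simps)
  have closed: "x \<in> tree_automorphisms n \<Longrightarrow> y \<in> tree_automorphisms n \<Longrightarrow>
      x \<otimes>\<^bsub>?A\<^esub> y \<in> tree_automorphisms n"
    "x \<in> tree_automorphisms n \<Longrightarrow> inv\<^bsub>?A\<^esub> x \<in> tree_automorphisms n" for x y
    using m_closed[of x y] inv_closed[of x] by auto
  have \<tau>: "?\<tau> \<in> tree_automorphisms n" using adding_machine_in_tree_Aut by simp
  have "\<forall>\<alpha>\<in>?L i. \<forall>k. \<exists>e. shifts_level n k \<alpha> e" if "i \<le> c" for i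
    using that
  proof (induction rule: inc_induct)
    case base
    show ?case using c shifts_level_one by auto
  next
    case (step i)
    show ?case
    proof (intro ballI allI)
      fix \<alpha> k assume \<alpha>: "\<alpha> \<in> ?L i"
      then have \<alpha>G: "\<alpha> \<in> G" and \<alpha>A: "\<alpha> \<in> tree_automorphisms n" using LG GA by auto
      let ?conj = "\<lambda>x. \<alpha> \<otimes>\<^bsub>?A\<^esub> x \<otimes>\<^bsub>?A\<^esub> inv\<^bsub>?A\<^esub> \<alpha>"
      have conjA: "?conj x \<in> tree_automorphisms n" if "x \<in> tree_automorphisms n" for x
        using closed \<alpha>A that by simp
      \<comment> \<open>Level \<open>c * k\<close> is deep enough to pass from \<open>(1 - a) ^ c\<close> to \<open>1 - a\<close> below.\<close>
      obtain e where "shifts_level n (c * k) (?conj ?\<tau> \<otimes>\<^bsub>?A\<^esub> inv\<^bsub>?A\<^esub> ?\<tau>) e"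
        using step.IH comm[OF \<alpha> \<tau>G] by blast
      from shifts_level_mult[OF _ this shifts_level_adding_machine]
      have "shifts_level n (c * k) (?conj ?\<tau> \<otimes>\<^bsub>?A\<^esub> inv\<^bsub>?A\<^esub> ?\<tau> \<otimes>\<^bsub>?A\<^esub> ?\<tau>) (e + 1)"
        using closed conjA \<tau> by simp
      moreover have "?conj ?\<tau> \<otimes>\<^bsub>?A\<^esub> inv\<^bsub>?A\<^esub> ?\<tau> \<otimes>\<^bsub>?A\<^esub> ?\<tau> = ?conj ?\<tau>"
        using conjA[OF \<tau>] \<tau> closed by (simp add: m_assoc)
      ultimately obtain a where a: "shifts_level n (c * k) (?conj ?\<tau>) a" by auto
      \<comment> \<open>The iterated commutators of \<open>\<tau>\<close> with \<open>\<alpha>\<close>: conjugating \<open>\<tau> ^ (- b)\<close> by \<open>\<alpha>\<close> gives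
        \<open>\<tau> ^ (- b * a)\<close>, so each commutator multiplies the exponent by \<open>1 - a\<close>.\<close>
      have iter: "\<exists>x\<in>?L j. shifts_level n (c * k) x ((1 - a) ^ j)" for j
      proof (induction j)
        case 0
        show ?case using \<tau>G shifts_level_adding_machine by auto
      next
        case (Suc j)
        then obtain x where x: "x \<in> ?L j" "shifts_level n (c * k) x ((1 - a) ^ j)" by blast
        have xA: "x \<in> tree_automorphisms n" using x(1) LG GA by blast
        have "shifts_level n (c * k) (x \<otimes>\<^bsub>?A\<^esub> ?conj (inv\<^bsub>?A\<^esub> x)) ((1 - a) ^ j + (- ((1 - a) ^ j)) * a)"
          by (intro shifts_level_mult shifts_level_conj shifts_level_inv n xA closed \<alpha>A x(2) a)
        moreover have "x \<otimes>\<^bsub>?A\<^esub> ?conj (inv\<^bsub>?A\<^esub> x) = x \<otimes>\<^bsub>?A\<^esub> \<alpha> \<otimes>\<^bsub>?A\<^esub> inv\<^bsub>?A\<^esub> x \<otimes>\<^bsub>?A\<^esub> inv\<^bsub>?A\<^esub> \<alpha>"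
          using xA \<alpha>A closed by (simp add: m_assoc)
        ultimately show ?case using comm[OF x(1) \<alpha>G]
          by (intro bexI[of _ "x \<otimes>\<^bsub>?A\<^esub> ?conj (inv\<^bsub>?A\<^esub> x)"]) (auto simp: algebra_simps)
      qed
      have "shifts_level n (c * k) \<one>\<^bsub>?A\<^esub> ((1 - a) ^ c)" using iter[of c] c by simp
      then have "[(1 - a) ^ c = 0] (mod int n ^ (c * k))"
        using shifts_level_exponents_cong[OF n] shifts_level_one by blast
      then have "(int n ^ k) ^ c dvd (1 - a) ^ c"
        by (simp add: cong_0_iff mult.commute flip: power_mult)
      then have "int n ^ k dvd 1 - a" using step.hyps by (simp add: pow_divides_pow_iff)
      then have "[a = 1] (mod int n ^ k)"
        by (simp add: cong_iff_dvd_diff dvd_diff_commute)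
      moreover have "shifts_level n k (?conj ?\<tau>) a"
        using shifts_level_mono[OF n conjA[OF \<tau>] a] step.hyps by simp
      ultimately show "\<exists>e. shifts_level n k \<alpha> e"
        using shifts_level_if_commutes[OF n \<alpha>A] shifts_level_cong_exponent by blast
    qed
  qed
  from this[of 0] show ?thesis using \<open>\<alpha> \<in> G\<close> by simp
qed

theorem proposition3p3:
  fixes n :: nat and G :: "(nat list \<Rightarrow> nat list) set"
  assumes "n \<ge> 2"
    and "subgroup G (tree_Aut n)"
    and "nilpotent_group ((tree_Aut n)\<lparr>carrier := G\<rparr>)"
    and "adding_machine n \<in> G"
  shows "subgroup G ((tree_Aut n)\<lparr>carrier := adding_machine_closure n\<rparr>)"
proof -
  interpret group "tree_Aut n" by (rule group_tree_Aut)
  let ?A = "tree_Aut n" and ?C = "adding_machine_closure n"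
  obtain c where c: "lower_central_series (?A\<lparr>carrier := G\<rparr>) c = {\<one>\<^bsub>?A\<^esub>}"
    using assms(3) by (auto simp: nilpotent_group_def)
  have n: "n > 0" using assms(1) by simp
  have GA: "x \<in> carrier ?A" if "x \<in> G" for x using subgroup.mem_carrier[OF assms(2) that] .
  have GC: "x \<in> ?C" if "x \<in> G" for x
    using in_adding_machine_closure[OF n] GA[OF that]
      nilpotent_subgroup_shifts_level[OF n assms(2,4) c that] by simp
  have CA: "?C \<subseteq> carrier ?A"
    using closure_of_subset_topspace[of "profinite_topology n"]
    by (auto simp: adding_machine_closure_def topspace_profinite_topology)
  \<comment> \<open>The inverse in the structure on the closure is that of the full automorphism group.\<close>
  have inv: "inv\<^bsub>?A\<lparr>carrier := ?C\<rparr>\<^esub> x = inv\<^bsub>?A\<^esub> x" if x: "x \<in> G" for x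
    unfolding m_inv_def[of "?A\<lparr>carrier := ?C\<rparr>"]
  proof (rule the_equality)
    have "inv\<^bsub>?A\<^esub> x \<in> ?C" using GC subgroup.m_inv_closed[OF assms(2) x] by blast
    then show "inv\<^bsub>?A\<^esub> x \<in> carrier (?A\<lparr>carrier := ?C\<rparr>) \<and>
        x \<otimes>\<^bsub>?A\<lparr>carrier := ?C\<rparr>\<^esub> inv\<^bsub>?A\<^esub> x = \<one>\<^bsub>?A\<lparr>carrier := ?C\<rparr>\<^esub> \<and>
        inv\<^bsub>?A\<^esub> x \<otimes>\<^bsub>?A\<lparr>carrier := ?C\<rparr>\<^esub> x = \<one>\<^bsub>?A\<lparr>carrier := ?C\<rparr>\<^esub>"
      using GA[OF x] r_inv[of x] l_inv[of x] by simp
  next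
    fix y assume "y \<in> carrier (?A\<lparr>carrier := ?C\<rparr>) \<and>
        x \<otimes>\<^bsub>?A\<lparr>carrier := ?C\<rparr>\<^esub> y = \<one>\<^bsub>?A\<lparr>carrier := ?C\<rparr>\<^esub> \<and>
        y \<otimes>\<^bsub>?A\<lparr>carrier := ?C\<rparr>\<^esub> x = \<one>\<^bsub>?A\<lparr>carrier := ?C\<rparr>\<^esub>"
    then have "y \<in> carrier ?A" "y \<otimes>\<^bsub>?A\<^esub> x = \<one>\<^bsub>?A\<^esub>" using CA by auto
    then show "y = inv\<^bsub>?A\<^esub> x" using inv_equality GA[OF x] by simp
  qed
  show ?thesis
    using GC inv subgroup.m_closed[OF assms(2)] subgroup.one_closed[OF assms(2)]
      subgroup.m_inv_closed[OF assms(2)]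
    by (intro subgroup.intro) auto
qed

end
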